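(* Let $\mathbb{K}$ be a field of characteristic $0$. Let $b,g\in\mathbb{K}[[t]]$ have nonzero constant terms with $g$ even, $g(t)=\sum_{n\ge0}g_{2n}t^{2n}$, and let $f_1,f_2\in\mathbb{K}[[t]]$ be odd of order $1$, $f_i(t)=\sum_{n\ge0}f_{i,2n+1}t^{2n+1}$ with $f_{i,1}\neq0$. Let $D=(b|g;f_1,f_2)$ be the double almost-Riordan array. For $u(t)=\sum_{n\ge0}u_nt^n\in\mathbb{K}[[t]]$ let $v(t)$ denote the generating function of the column vector $D\,(u_0,u_1,u_2,\ldots)^T$ (written $D\,u(t)=v(t)$). (a) If $u$ is even, $u(t)=\sum_{k\ge0}u_{2k}t^{2k}$, then $$v(t)=u_0\,b(t)+\frac{t g(t)}{f_2(t)}\Big(u\big(\sqrt{f_1f_2}\big)-u_0\Big).$$ (b) If $u$ is odd, $u(t)=\sum_{k\ge0}u_{2k+1}t^{2k+1}$, then $$v(t)=\frac{t g(t)}{\sqrt{f_1f_2}}\,u\big(\sqrt{f_1f_2}\big).$$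
   Context: The double almost-Riordan array $(b|g;f_1,f_2)$ is the infinite lower triangular matrix $(d_{n,k})_{n,k\ge0}$ whose $k$-th column has generating function $\sum_{n}d_{n,k}t^n$ equal to $b$ for $k=0$, to $t g (f_1f_2)^{\ell}$ for $k=2\ell+1$, and to $t g f_1 (f_1f_2)^{\ell}$ for $k=2\ell+2$ ($\ell\ge0$); i.e. its columns are $(b,\ tg,\ tgf_1,\ tgf_1f_2,\ tgf_1^2f_2,\ tgf_1^2f_2^2,\ldots)$. Notation: for even $u$, $u(\sqrt{f_1f_2})$ means $\sum_{k\ge0}u_{2k}(f_1f_2)^k$, so that $\frac{tg}{f_2}(u(\sqrt{f_1f_2})-u_0)=tgf_1\sum_{k\ge1}u_{2k}(f_1f_2)^{k-1}$; for odd $u$, $\frac{1}{\sqrt{f_1f_2}}u(\sqrt{f_1f_2})$ means $\sum_{k\ge0}u_{2k+1}(f_1f_2)^k$. *)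

theory Defs
  imports "HOL-Computational_Algebra.Formal_Power_Series" "HOL-Library.Groups_Big_Fun"
begin

unbundle fps_syntax

definition fps_even :: "'a::zero fps \<Rightarrow> bool" where
  "fps_even u \<longleftrightarrow> (\<forall>n. odd n \<longrightarrow> u $ n = 0)"

definition fps_odd :: "'a::zero fps \<Rightarrow> bool" where
  "fps_odd u \<longleftrightarrow> (\<forall>n. even n \<longrightarrow> u $ n = 0)"

definition double_almost_riordan_column ::
    "'a::field fps \<Rightarrow> 'a fps \<Rightarrow> 'a fps \<Rightarrow> 'a fps \<Rightarrow> nat \<Rightarrow> 'a fps" where
  "double_almost_riordan_column b g f1 f2 k =
     (if k = 0 then b
      else if odd k then fps_X * g * (f1 * f2) ^ ((k - 1) div 2)
      else fps_X * g * f1 * (f1 * f2) ^ ((k - 2) div 2))"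

definition double_almost_riordan ::
    "'a::field fps \<Rightarrow> 'a fps \<Rightarrow> 'a fps \<Rightarrow> 'a fps \<Rightarrow> nat \<Rightarrow> nat \<Rightarrow> 'a" where
  "double_almost_riordan b g f1 f2 n k = double_almost_riordan_column b g f1 f2 k $ n"

text \<open>The sum over all column indices is meaningful for matrices with finitely supported rows,
  in particular for lower triangular ones.\<close>

definition matrix_apply_fps :: "(nat \<Rightarrow> nat \<Rightarrow> 'a::field) \<Rightarrow> 'a fps \<Rightarrow> 'a fps" where
  "matrix_apply_fps D u = Abs_fps (\<lambda>n. Sum_any (\<lambda>k. D n k * u $ k))"

text \<open>For \<open>F $ 0 = 0\<close>, the next two series are \<open>\<Sum>k. u $ (2 * k) * F ^ k\<close> and
  \<open>\<Sum>k. u $ (2 * k + 1) * F ^ k\<close>. For even \<open>u\<close> the former is \<open>u(\<surd>F)\<close>, for odd \<open>u\<close> the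
  latter is \<open>u(\<surd>F) / \<surd>F\<close>; no square root of \<open>F\<close> needs to exist in the power series ring.\<close>

definition fps_even_at_sqrt :: "'a::field fps \<Rightarrow> 'a fps \<Rightarrow> 'a fps" where
  "fps_even_at_sqrt u F = Abs_fps (\<lambda>k. u $ (2 * k)) oo F"

definition fps_odd_at_sqrt_over_sqrt :: "'a::field fps \<Rightarrow> 'a fps \<Rightarrow> 'a fps" where
  "fps_odd_at_sqrt_over_sqrt u F = Abs_fps (\<lambda>k. u $ (2 * k + 1)) oo F"

lemma fps_even_at_sqrt_square:
  fixes u s :: "'a::field fps"
  assumes "fps_even u" "s $ 0 = 0"
  shows "fps_even_at_sqrt u (s ^ 2) = u oo s"
proof -
  have "u = Abs_fps (\<lambda>k. u $ (2 * k)) oo fps_X ^ 2"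
  proof (rule fps_ext)
    fix n
    have "((fps_X :: 'a fps) ^ 2) ^ i $ n = (if n = 2 * i then 1 else 0)" for i
      unfolding power_mult[symmetric] by simp
    then have "(Abs_fps (\<lambda>k. u $ (2 * k)) oo fps_X ^ 2) $ n =
          (\<Sum>i = 0..n. if n = 2 * i then u $ (2 * i) else 0)"
      by (auto simp: fps_compose_nth intro!: sum.cong)
    also have "\<dots> = u $ n"
    proof (cases "even n")
      case True
      then obtain m where m: "n = 2 * m" by blast
      have "(\<Sum>i = 0..n. if n = 2 * i then u $ (2 * i) else 0) =
            (\<Sum>i = 0..n. if i = m then u $ (2 * m) else 0)"
        by (rule sum.cong) (auto simp: m)
      then show ?thesis by (simp add: m)
    next
      case False
      then show ?thesis using assms(1) by (auto simp: fps_even_def intro!: sum.neutral)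
    qed
    finally show "u $ n = (Abs_fps (\<lambda>k. u $ (2 * k)) oo fps_X ^ 2) $ n" ..
  qed
  then have "u oo s = (Abs_fps (\<lambda>k. u $ (2 * k)) oo fps_X ^ 2) oo s" by simp
  also have "\<dots> = Abs_fps (\<lambda>k. u $ (2 * k)) oo (fps_X ^ 2 oo s)"
    by (rule fps_compose_assoc[symmetric]) (use assms in auto)
  also have "fps_X ^ 2 oo s = s ^ 2"
    using assms(2) by (simp add: power2_eq_square fps_compose_mult_distrib)
  finally show ?thesis by (simp add: fps_even_at_sqrt_def)
qed

lemma fps_odd_at_sqrt_over_sqrt_square:
  fixes u s :: "'a::field fps"
  assumes "fps_odd u" "s $ 0 = 0"
  shows "s * fps_odd_at_sqrt_over_sqrt u (s ^ 2) = u oo s"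
proof -
  define w where "w = fps_shift 1 u"
  have "u $ 0 = 0" using assms(1) by (auto simp: fps_odd_def)
  then have u: "u = fps_X * w"
    by (auto simp: w_def fps_eq_iff)
  have "fps_even w" using assms(1) by (auto simp: w_def fps_odd_def fps_even_def)
  from fps_even_at_sqrt_square[OF this assms(2)]
  have "w oo s = fps_odd_at_sqrt_over_sqrt u (s ^ 2)"
    by (simp add: fps_even_at_sqrt_def fps_odd_at_sqrt_over_sqrt_def w_def)
  then show ?thesis
    using assms(2) by (simp add: u fps_compose_mult_distrib)
qed

lemma double_almost_riordan_lower_triangular:
  fixes b g f1 f2 :: "'a::field fps"
  assumes "f1 $ 0 = 0" "f2 $ 0 = 0" "n < k"
  shows "double_almost_riordan b g f1 f2 n k = 0"
proof -
  obtain p q where f: "f1 = fps_X * p" "f2 = fps_X * q"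
  proof
    show "f1 = fps_X * fps_shift 1 f1" "f2 = fps_X * fps_shift 1 f2"
      using assms by (auto simp: fps_eq_iff)
  qed
  have "\<exists>r. double_almost_riordan_column b g f1 f2 k = fps_X ^ k * r"
  proof (cases "odd k")
    case True
    then obtain l where k: "k = 2 * l + 1" by (elim oddE)
    show ?thesis
      by (rule exI[of _ "g * (p * q) ^ l"])
         (simp add: double_almost_riordan_column_def k f power_mult_distrib power_mult
            power2_eq_square mult_ac)
  next
    case False
    then obtain l where k: "k = 2 * l + 2"
      using assms(3) by (metis Suc_pred add_2_eq_Suc' evenE gr0I less_nat_zero_code
          mult_Suc_right mult_is_0 add.commute)
    show ?thesis
      by (rule exI[of _ "g * p * (p * q) ^ l"])
         (simp add: double_almost_riordan_column_def k f power_mult_distrib power_mult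
            power2_eq_square mult_ac)
  qed
  then show ?thesis
    using assms(3) by (auto simp: double_almost_riordan_def fps_X_power_mult_nth)
qed

end

theory Submission
  imports Defs
begin

(* With F = f1 * f2, the columns of odd index 2l + 1 are t g F^l and those of even index 2l + 2 are
   t g f1 F^l. Splitting D u by the parity of the column index therefore gives, for every u,
   u_0 b plus two compositions with F, of which only one survives when u is even or odd. In
   the even case it runs over u_2, u_4, ..., and t g f1 = (t g / f2) F completes it to
   u(sqrt F) - u_0. *)

lemma fps_compose_nth_atMost:
  fixes a F :: "'a::comm_semiring_1 fps"
  assumes "F $ 0 = 0" and "n \<le> N"
  shows "(a oo F) $ n = (\<Sum>k\<le>N. a $ k * (F ^ k) $ n)"
  unfolding fps_compose_nth
  by (rule sum.mono_neutral_left) (use assms startsby_zero_power_prefix[of F] in auto)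

lemma fps_mult_compose_nth_atMost:
  fixes a c F :: "'a::comm_semiring_1 fps"
  assumes "F $ 0 = 0" and "n \<le> N"
  shows "(c * (a oo F)) $ n = (\<Sum>k\<le>N. (c * F ^ k) $ n * a $ k)"
proof -
  have "(c * (a oo F)) $ n = (\<Sum>j=0..n. c $ j * (\<Sum>k\<le>N. a $ k * (F ^ k) $ (n - j)))"
    unfolding fps_mult_nth using assms by (simp add: fps_compose_nth_atMost[where N = N])
  also have "\<dots> = (\<Sum>j=0..n. \<Sum>k\<le>N. c $ j * (F ^ k) $ (n - j) * a $ k)"
    by (simp add: sum_distrib_left mult_ac)
  also have "\<dots> = (\<Sum>k\<le>N. \<Sum>j=0..n. c $ j * (F ^ k) $ (n - j) * a $ k)"
    by (rule sum.swap)
  finally show ?thesis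
    by (simp add: fps_mult_nth sum_distrib_right)
qed

lemma fps_dvd_fps_X:
  fixes f :: "'a::field fps"
  assumes "f $ 1 \<noteq> 0"
  shows "f dvd fps_X"
proof -
  have "f \<noteq> 0" and "subdegree f \<le> 1"
    using assms by (auto intro: subdegree_leI)
  then show ?thesis
    by (simp add: fps_dvd_iff)
qed

lemma matrix_apply_fps_nth_lower_triangular:
  fixes D :: "nat \<Rightarrow> nat \<Rightarrow> 'a::field" and u :: "'a fps"
  assumes "\<And>k. n < k \<Longrightarrow> D n k = 0" and "n \<le> N"
  shows "matrix_apply_fps D u $ n = (\<Sum>k\<le>N. D n k * u $ k)"
proof -
  have "{k. D n k * u $ k \<noteq> 0} \<subseteq> {..N}"
    using assms by (force simp: not_less)
  then show ?thesis
    by (simp add: matrix_apply_fps_def Sum_any.expand_superset[of "{..N}"])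
qed

lemma sum_atMost_split_parity:
  fixes h :: "nat \<Rightarrow> 'a::comm_monoid_add"
  shows "(\<Sum>k\<le>2 * n + 2. h k) =
    h 0 + (\<Sum>l\<le>n. h (2 * l + 1)) + (\<Sum>l\<le>n. h (2 * l + 2))"
proof -
  have "(\<Sum>k\<le>2 * n + 2. h k) = h 0 + (\<Sum>k\<le>Suc (2 * n). h (Suc k))"
    by (simp add: sum.atMost_Suc_shift del: sum.atMost_Suc)
  also have "\<dots> = h 0 + (\<Sum>l\<le>n. h (2 * l + 1) + h (2 * l + 2))"
    by (subst sum.in_pairs_0) simp
  finally show ?thesis
    by (simp add: sum.distrib add.assoc)
qed

lemma fps_even_at_sqrt_eq_shift:
  fixes u F :: "'a::field fps"
  assumes "F $ 0 = 0"
  shows "fps_even_at_sqrt u F = fps_const (u $ 0) + F * fps_even_at_sqrt (fps_shift 2 u) F"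
proof -
  have "Abs_fps (\<lambda>k. u $ (2 * k)) =
      fps_const (u $ 0) + fps_X * Abs_fps (\<lambda>k. fps_shift 2 u $ (2 * k))"
    by (rule fps_ext) (auto simp: gr0_conv_Suc)
  then show ?thesis
    using assms
    by (simp add: fps_even_at_sqrt_def fps_compose_add_distrib fps_compose_mult_distrib)
qed

lemma fps_even_at_sqrt_eq_0_if_odd:
  fixes u F :: "'a::field fps"
  assumes "fps_odd u"
  shows "fps_even_at_sqrt u F = 0"
proof -
  have "Abs_fps (\<lambda>k. u $ (2 * k)) = 0"
    using assms by (simp add: fps_odd_def fps_eq_iff)
  then show ?thesis
    by (simp add: fps_even_at_sqrt_def)
qed

lemma fps_odd_at_sqrt_over_sqrt_eq_0_if_even:
  fixes u F :: "'a::field fps"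
  assumes "fps_even u"
  shows "fps_odd_at_sqrt_over_sqrt u F = 0"
proof -
  have "Abs_fps (\<lambda>k. u $ (2 * k + 1)) = 0"
    using assms by (simp add: fps_even_def fps_eq_iff)
  then show ?thesis
    by (simp add: fps_odd_at_sqrt_over_sqrt_def)
qed

theorem matrix_apply_fps_double_almost_riordan:
  fixes b g f1 f2 u :: "'a::field fps"
  assumes "f1 $ 0 = 0" and "f2 $ 0 = 0"
  shows "matrix_apply_fps (double_almost_riordan b g f1 f2) u =
    fps_const (u $ 0) * b +
    fps_X * g * fps_odd_at_sqrt_over_sqrt u (f1 * f2) +
    fps_X * g * f1 * fps_even_at_sqrt (fps_shift 2 u) (f1 * f2)"
proof (rule fps_ext)
  fix n
  let ?D = "double_almost_riordan b g f1 f2" and ?F = "f1 * f2"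
  have F0: "?F $ 0 = 0"
    using assms by simp
  have column_0: "?D n 0 * u $ 0 = (fps_const (u $ 0) * b) $ n"
    by (simp add: double_almost_riordan_def double_almost_riordan_column_def mult.commute)
  have odd_columns: "(\<Sum>l\<le>n. ?D n (2 * l + 1) * u $ (2 * l + 1)) =
      (fps_X * g * fps_odd_at_sqrt_over_sqrt u ?F) $ n"
    unfolding fps_odd_at_sqrt_over_sqrt_def fps_mult_compose_nth_atMost[OF F0 order_refl]
    by (simp add: double_almost_riordan_def double_almost_riordan_column_def)
  have even_columns: "(\<Sum>l\<le>n. ?D n (2 * l + 2) * u $ (2 * l + 2)) =
      (fps_X * g * f1 * fps_even_at_sqrt (fps_shift 2 u) ?F) $ n"
    unfolding fps_even_at_sqrt_def fps_mult_compose_nth_atMost[OF F0 order_refl]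
    by (simp add: double_almost_riordan_def double_almost_riordan_column_def)
  have "matrix_apply_fps ?D u $ n = (\<Sum>k\<le>2 * n + 2. ?D n k * u $ k)"
    using double_almost_riordan_lower_triangular[OF assms]
    by (intro matrix_apply_fps_nth_lower_triangular) auto
  then show "matrix_apply_fps ?D u $ n =
      (fps_const (u $ 0) * b + fps_X * g * fps_odd_at_sqrt_over_sqrt u ?F +
       fps_X * g * f1 * fps_even_at_sqrt (fps_shift 2 u) ?F) $ n"
    unfolding sum_atMost_split_parity column_0 odd_columns even_columns fps_add_nth .
qed

corollary matrix_apply_fps_double_almost_riordan_even:
  fixes b g f1 f2 u :: "'a::field fps"
  assumes "f1 $ 0 = 0" and "f2 $ 0 = 0" and "f2 $ 1 \<noteq> 0" and "fps_even u"
  shows "matrix_apply_fps (double_almost_riordan b g f1 f2) u =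
    fps_const (u $ 0) * b +
    (fps_X * g / f2) * (fps_even_at_sqrt u (f1 * f2) - fps_const (u $ 0))"
proof -
  let ?tail = "fps_even_at_sqrt (fps_shift 2 u) (f1 * f2)"
  have "f2 dvd fps_X * g"
    using assms(3) by (intro dvd_mult2 fps_dvd_fps_X)
  then have "fps_X * g * f1 * ?tail = (fps_X * g / f2 * f2) * f1 * ?tail"
    by simp
  also have "\<dots> = (fps_X * g / f2) * (f1 * f2 * ?tail)"
    by (simp only: mult_ac)
  also have "f1 * f2 * ?tail = fps_even_at_sqrt u (f1 * f2) - fps_const (u $ 0)"
    using assms(1) by (simp add: fps_even_at_sqrt_eq_shift[of _ u])
  finally show ?thesis
    using assms
    by (simp add: matrix_apply_fps_double_almost_riordan
        fps_odd_at_sqrt_over_sqrt_eq_0_if_even)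
qed

corollary matrix_apply_fps_double_almost_riordan_odd:
  fixes b g f1 f2 u :: "'a::field fps"
  assumes "f1 $ 0 = 0" and "f2 $ 0 = 0" and "fps_odd u"
  shows "matrix_apply_fps (double_almost_riordan b g f1 f2) u =
    fps_X * g * fps_odd_at_sqrt_over_sqrt u (f1 * f2)"
proof -
  have "u $ 0 = 0" and "fps_odd (fps_shift 2 u)"
    using assms(3) by (auto simp: fps_odd_def)
  then show ?thesis
    using assms
    by (simp add: matrix_apply_fps_double_almost_riordan fps_even_at_sqrt_eq_0_if_odd)
qed

theorem theorem2p2:
  fixes b g f1 f2 u :: "'a::field_char_0 fps"
  assumes "b $ 0 \<noteq> 0" and "g $ 0 \<noteq> 0" and "fps_even g"
    and "fps_odd f1" and "f1 $ 1 \<noteq> 0"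
    and "fps_odd f2" and "f2 $ 1 \<noteq> 0"
  shows "(fps_even u \<longrightarrow>
            matrix_apply_fps (double_almost_riordan b g f1 f2) u =
              fps_const (u $ 0) * b +
              (fps_X * g / f2) * (fps_even_at_sqrt u (f1 * f2) - fps_const (u $ 0))) \<and>
         (fps_odd u \<longrightarrow>
            matrix_apply_fps (double_almost_riordan b g f1 f2) u =
              fps_X * g * fps_odd_at_sqrt_over_sqrt u (f1 * f2))"
proof -
  have "f1 $ 0 = 0" and "f2 $ 0 = 0"
    using \<open>fps_odd f1\<close> \<open>fps_odd f2\<close> by (simp_all add: fps_odd_def)
  then show ?thesis
    using \<open>f2 $ 1 \<noteq> 0\<close> matrix_apply_fps_double_almost_riordan_even
      matrix_apply_fps_double_almost_riordan_odd by blast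
qed

end
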